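(* Let $X$ be a path-connected topological space. Write $\mathrm{TC}_{\text{étale}}(X)$ for the étale topological complexity of $X$. Then \[ \mathrm{TC}_{\text{étale}}(X)=\begin{cases}1, & \text{if } X \text{ is locally contractible},\\ \infty, & \text{if } X \text{ is not locally contractible}.\end{cases} \]
   Context: "Space" means topological space and "map" means continuous map. Étale map: a map $\varphi:A\to Y$ is étale if it is a local homeomorphism, i.e. for each $a\in A$ there is an open subset $O$ of $A$ with $a\in O$ such that $\varphi(O)$ is open in $Y$ and the restriction $\varphi_{|}:O\to\varphi(O)$ is a homeomorphism. (No separation, connectedness or surjectivity assumptions are made.) Étale sectional number: for a map $f:E\to Y$, $\text{Étale-sec}(f)$ is the least positive integer $m$ such that there exist étale maps $\varphi_1:A_1\to Y,\ldots,\varphi_m:A_m\to Y$ with $Y=\varphi_1(A_1)\cup\cdots\cup\varphi_m(A_m)$ and, for each $i=1,\ldots,m$, a map $\sigma_i:A_i\to E$ satisfying $f\circ\sigma_i=\varphi_i$. If no such $m$ exists, $\text{Étale-sec}(f)=\infty$. Étale topological complexity: let $X^{[0,1]}$ be the space of all continuous paths $\gamma:[0,1]\to X$ with the compact-open topology, and let $e_2^X:X^{[0,1]}\to X\times X$ be the map $e_2^X(\gamma)=(\gamma(0),\gamma(1))$. Then $\mathrm{TC}_{\text{étale}}(X)=\text{Étale-sec}(e_2^X)$. Locally contractible (in the sense used here): $X$ is locally contractible if for each $x\in X$ there is an open subset $U$ of $X$ with $x\in U$ such that the inclusion map $U\hookrightarrow X$ is null-homotopic (homotopic to a constant map). Equivalently,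 $X$ has an open covering $\{U_\lambda\}_{\lambda\in\Lambda}$ such that each inclusion $U_\lambda\hookrightarrow X$ is null-homotopic. *)

theory Defs
  imports "HOL-Analysis.Analysis"
begin

section \<open>Etale maps and the etale sectional number\<close>

definition etale_map :: "'a topology \<Rightarrow> 'b topology \<Rightarrow> ('a \<Rightarrow> 'b) \<Rightarrow> bool" where
  "etale_map A Y \<phi> \<longleftrightarrow>
     continuous_map A Y \<phi> \<and>
     (\<forall>a \<in> topspace A. \<exists>U. openin A U \<and> a \<in> U \<and> openin Y (\<phi> ` U) \<and>
        homeomorphic_map (subtopology A U) (subtopology Y (\<phi> ` U)) \<phi>)"

text \<open>
  The etale spaces are arbitrary topological spaces. As HOL does not quantify over types inside a
  formula, the type \<open>'c\<close> of their points is a parameter, playing the role of a universe.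
  Finitely many etale spaces over different types can be moved into one type, so a single
  \<open>'c\<close> suffices. Lemma \<open>has_etale_sections_universe\<close> below shows that every type \<open>'c\<close> into
  which \<open>'y \<times> 'y\<close> embeds is large enough: spaces over other types give nothing new.
\<close>

definition has_etale_sections ::
    "'c itself \<Rightarrow> 'e topology \<Rightarrow> 'y topology \<Rightarrow> ('e \<Rightarrow> 'y) \<Rightarrow> nat \<Rightarrow> bool" where
  "has_etale_sections _ E Y f m \<longleftrightarrow>
     (\<exists>(A :: nat \<Rightarrow> 'c topology) \<phi> \<sigma>.
        (\<forall>i \<in> {1..m}. etale_map (A i) Y (\<phi> i)) \<and>
        topspace Y = (\<Union>i \<in> {1..m}. \<phi> i ` topspace (A i)) \<and>
        (\<forall>i \<in> {1..m}. continuous_map (A i) E (\<sigma> i) \<and>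
           (\<forall>a \<in> topspace (A i). f (\<sigma> i a) = \<phi> i a)))"

text \<open>In \<^typ>\<open>enat\<close> the infimum of the empty set is \<open>\<infinity>\<close>.\<close>

definition etale_sec ::
    "'c itself \<Rightarrow> 'e topology \<Rightarrow> 'y topology \<Rightarrow> ('e \<Rightarrow> 'y) \<Rightarrow> enat" where
  "etale_sec U E Y f = Inf {enat m | m. m \<ge> 1 \<and> has_etale_sections U E Y f m}"

lemma etale_map_compose_homeomorphic:
  assumes h: "homeomorphic_map B P h" and e: "etale_map P Y \<psi>"
  shows "etale_map B Y (\<psi> \<circ> h)"
  unfolding etale_map_def
proof (intro conjI ballI)
  show "continuous_map B Y (\<psi> \<circ> h)"
    using h e by (meson continuous_map_compose etale_map_def homeomorphic_imp_continuous_map)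
  fix b assume b: "b \<in> topspace B"
  have hB: "h ` topspace B = topspace P"
    using h by (rule homeomorphic_imp_surjective_map)
  then have "h b \<in> topspace P" using b by blast
  then obtain V where V: "openin P V" "h b \<in> V" "openin Y (\<psi> ` V)"
      "homeomorphic_map (subtopology P V) (subtopology Y (\<psi> ` V)) \<psi>"
    using e unfolding etale_map_def by blast
  define W where "W = {b \<in> topspace B. h b \<in> V}"
  have hW: "h ` W = V"
    using openin_subset[OF V(1)] unfolding W_def hB[symmetric] by auto
  have im: "(\<psi> \<circ> h) ` W = \<psi> ` V"
    by (metis hW image_comp)
  have "openin B W"
    unfolding W_def
    using openin_continuous_map_preimage[OF homeomorphic_imp_continuous_map[OF h] V(1)] .
  moreover have "homeomorphic_map (subtopology B W) (subtopology P V) h"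
  proof (rule homeomorphic_map_subtopologies[OF h])
    show "h ` (topspace B \<inter> W) = topspace P \<inter> V"
      using hW openin_subset[OF V(1)] by (auto simp: W_def)
  qed
  then have "homeomorphic_map (subtopology B W) (subtopology Y ((\<psi> \<circ> h) ` W)) (\<psi> \<circ> h)"
    unfolding im using V(4) by (rule homeomorphic_map_compose)
  moreover have "b \<in> W" "openin Y ((\<psi> \<circ> h) ` W)"
    using b V(2,3) unfolding im by (simp_all add: W_def)
  ultimately show "\<exists>U. openin B U \<and> b \<in> U \<and> openin Y ((\<psi> \<circ> h) ` U) \<and>
        homeomorphic_map (subtopology B U) (subtopology Y ((\<psi> \<circ> h) ` U)) (\<psi> \<circ> h)"
    by blast
qed

lemma continuous_map_from_sum_topology:
  assumes "\<And>i. i \<in> J \<Longrightarrow> continuous_map (X i) Z (\<lambda>x. g (i, x))"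
  shows "continuous_map (sum_topology X J) Z g"
  unfolding continuous_map
proof (intro conjI allI impI)
  show "g ` topspace (sum_topology X J) \<subseteq> topspace Z"
    using assms unfolding continuous_map by fastforce
  fix W assume W: "openin Z W"
  have "openin (X i) {x. (i, x) \<in> {p \<in> topspace (sum_topology X J). g p \<in> W}}"
    if i: "i \<in> J" for i
  proof -
    have "{x. (i, x) \<in> {p \<in> topspace (sum_topology X J). g p \<in> W}} =
        {x \<in> topspace (X i). g (i, x) \<in> W}"
      using i by auto
    then show ?thesis
      using assms[OF i] W by (simp add: openin_continuous_map_preimage)
  qed
  then show "openin (sum_topology X J) {p \<in> topspace (sum_topology X J). g p \<in> W}"
    unfolding openin_sum_topology by auto
qed

lemma etale_map_transfer:
  fixes A :: "'c topology" and Y :: "'y topology" and E :: "'e topology"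
    and \<iota> :: "'y \<times> 'y \<Rightarrow> 'd"
  assumes inj: "inj \<iota>" and e: "etale_map A Y \<phi>" and s: "continuous_map A E \<sigma>"
    and fs: "\<And>a. a \<in> topspace A \<Longrightarrow> f (\<sigma> a) = \<phi> a"
  shows "\<exists>(B :: 'd topology) \<psi> \<tau>. etale_map B Y \<psi> \<and> \<psi> ` topspace B = \<phi> ` topspace A \<and>
           continuous_map B E \<tau> \<and> (\<forall>b \<in> topspace B. f (\<tau> b) = \<psi> b)"
proof -
  define J where "J = \<phi> ` topspace A"
  have "\<exists>U s. openin A U \<and> y \<in> \<phi> ` U \<and> openin Y (\<phi> ` U) \<and>
        homeomorphic_maps (subtopology A U) (subtopology Y (\<phi> ` U)) \<phi> s" if "y \<in> J" for y
  proof -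
    from that obtain a where a: "a \<in> topspace A" "y = \<phi> a" unfolding J_def by blast
    then show ?thesis
      using e unfolding etale_map_def homeomorphic_map_maps by blast
  qed
  then obtain U s where U: "\<And>y. y \<in> J \<Longrightarrow> openin A (U y) \<and> y \<in> \<phi> ` U y \<and> openin Y (\<phi> ` U y) \<and>
        homeomorphic_maps (subtopology A (U y)) (subtopology Y (\<phi> ` U y)) \<phi> (s y)"
    by metis
  define X where "X y = subtopology Y (\<phi> ` U y)" for y
  define P where "P = sum_topology X J"
  have tX: "topspace (X y) = \<phi> ` U y" if "y \<in> J" for y
    using U[OF that] openin_subset unfolding X_def by fastforce
  have tP: "topspace P = Sigma J (\<lambda>y. \<phi> ` U y)"
    unfolding P_def using tX by auto
  have opX: "openin (X y) W \<longleftrightarrow> openin Y W \<and> W \<subseteq> \<phi> ` U y" if "y \<in> J" for y W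
    unfolding X_def using U[OF that] by (meson openin_open_subtopology)
  have csnd: "continuous_map P Y snd"
    unfolding P_def by (rule continuous_map_from_sum_topology) (simp add: X_def continuous_map_from_subtopology continuous_map_id[unfolded id_def])
  have eP: "etale_map P Y snd"
    unfolding etale_map_def
  proof (intro conjI ballI csnd)
    fix p assume "p \<in> topspace P"
    then obtain y z where p: "p = (y, z)" and y: "y \<in> J" and z: "z \<in> \<phi> ` U y"
      unfolding tP by auto
    define V where "V = {y} \<times> \<phi> ` U y"
    have im: "snd ` V = \<phi> ` U y" unfolding V_def by force
    have VP: "V \<subseteq> topspace P" unfolding V_def tP using y by auto
    have "openin P V"
      unfolding P_def openin_sum_topology
    proof (intro conjI ballI)
      show "V \<subseteq> Sigma J (topspace \<circ> X)" using VP tP tX by auto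
      fix i assume "i \<in> J"
      show "openin (X i) {x. (i, x) \<in> V}"
      proof (cases "i = y")
        case True
        then show ?thesis using opX[OF y] U[OF y] by (simp add: V_def)
      qed (simp add: V_def)
    qed
    moreover have "homeomorphic_maps (subtopology P V) (subtopology Y (\<phi> ` U y)) snd (\<lambda>z. (y, z))"
      unfolding homeomorphic_maps_def
    proof (intro conjI)
      show "continuous_map (subtopology P V) (subtopology Y (\<phi> ` U y)) snd"
        using csnd by (auto simp: continuous_map_in_subtopology continuous_map_from_subtopology V_def)
      have "continuous_map (subtopology Y (\<phi> ` U y)) P (\<lambda>z. (y, z))"
        using continuous_map_component_injection[OF y, of X] unfolding P_def X_def .
      then show "continuous_map (subtopology Y (\<phi> ` U y)) (subtopology P V) (\<lambda>z. (y, z))"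
        by (auto simp: continuous_map_in_subtopology V_def)
    qed (auto simp: V_def)
    ultimately show "\<exists>U. openin P U \<and> p \<in> U \<and> openin Y (snd ` U) \<and>
        homeomorphic_map (subtopology P U) (subtopology Y (snd ` U)) snd"
      using im U[OF y] z p homeomorphic_map_maps
      by (intro exI[of _ V]) (auto simp: V_def)
  qed
  define \<rho> where "\<rho> = (\<lambda>(y, z). \<sigma> (s y z))"
  have c\<rho>: "continuous_map P E \<rho>"
    unfolding P_def
  proof (rule continuous_map_from_sum_topology)
    fix y assume y: "y \<in> J"
    have "continuous_map (X y) A (s y)"
      using U[OF y] unfolding X_def homeomorphic_maps_def
      by (auto simp: continuous_map_in_subtopology)
    then have "continuous_map (X y) E (\<sigma> \<circ> s y)"
      using s by (rule continuous_map_compose)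
    then show "continuous_map (X y) E (\<lambda>z. \<rho> (y, z))"
      by (simp add: \<rho>_def o_def)
  qed
  have f\<rho>: "f (\<rho> p) = snd p" if "p \<in> topspace P" for p
  proof -
    obtain y z where p: "p = (y, z)" and y: "y \<in> J" and z: "z \<in> \<phi> ` U y"
      using \<open>p \<in> topspace P\<close> unfolding tP by auto
    have zt: "z \<in> topspace (subtopology Y (\<phi> ` U y))" using tX[OF y] z X_def by simp
    have "s y z \<in> topspace A" "\<phi> (s y z) = z"
      using U[OF y] zt unfolding homeomorphic_maps_def continuous_map_def by auto
    then show ?thesis using fs p by (simp add: \<rho>_def)
  qed
  define B where "B = pullback_topology (\<iota> ` topspace P) (inv \<iota>) P"
  have tB: "topspace B = \<iota> ` topspace P"
    unfolding B_def topspace_pullback_topology using inj by auto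
  have "homeomorphic_maps B P (inv \<iota>) \<iota>"
    unfolding homeomorphic_maps_def
  proof (intro conjI)
    show "continuous_map B P (inv \<iota>)"
      unfolding B_def using continuous_map_pullback[of P P id] by simp
    show "continuous_map P B \<iota>"
      unfolding B_def using inj by (intro continuous_map_pullback') (auto simp: o_def)
  qed (use inj tB in auto)
  then have h: "homeomorphic_map B P (inv \<iota>)"
    using homeomorphic_map_maps by blast
  show ?thesis
  proof (intro exI conjI ballI)
    show "etale_map B Y (snd \<circ> inv \<iota>)"
      using h eP by (rule etale_map_compose_homeomorphic)
    have "snd ` topspace P = J"
    proof
      show "snd ` topspace P \<subseteq> J"
      proof
        fix z assume "z \<in> snd ` topspace P"
        then obtain y where y: "y \<in> J" and "z \<in> \<phi> ` U y" unfolding tP by auto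
        moreover have "U y \<subseteq> topspace A" using U[OF y] openin_subset by blast
        ultimately show "z \<in> J" unfolding J_def by blast
      qed
      show "J \<subseteq> snd ` topspace P"
      proof
        fix y assume "y \<in> J"
        then have "(y, y) \<in> topspace P" using U tP by auto
        then show "y \<in> snd ` topspace P" by force
      qed
    qed
    then show "(snd \<circ> inv \<iota>) ` topspace B = \<phi> ` topspace A"
      using homeomorphic_imp_surjective_map[OF h] J_def by (metis image_comp)
    show "continuous_map B E (\<rho> \<circ> inv \<iota>)"
      using h c\<rho> by (meson continuous_map_compose homeomorphic_imp_continuous_map)
    show "f ((\<rho> \<circ> inv \<iota>) b) = (snd \<circ> inv \<iota>) b" if "b \<in> topspace B" for b
    proof -
      have "inv \<iota> b \<in> topspace P"
        using homeomorphic_imp_surjective_map[OF h] that by blast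
      then show ?thesis using f\<rho> by simp
    qed
  qed
qed

lemma has_etale_sections_universe:
  fixes Y :: "'y topology" and \<iota> :: "'y \<times> 'y \<Rightarrow> 'd"
  assumes inj: "inj \<iota>" and sec: "has_etale_sections TYPE('c) E Y f m"
  shows "has_etale_sections TYPE('d) E Y f m"
proof -
  obtain A :: "nat \<Rightarrow> 'c topology" and \<phi> \<sigma> where
    A: "\<forall>i \<in> {1..m}. etale_map (A i) Y (\<phi> i)"
       "topspace Y = (\<Union>i \<in> {1..m}. \<phi> i ` topspace (A i))"
       "\<forall>i \<in> {1..m}. continuous_map (A i) E (\<sigma> i) \<and> (\<forall>a \<in> topspace (A i). f (\<sigma> i a) = \<phi> i a)"
    using sec unfolding has_etale_sections_def by blast
  have "\<forall>i \<in> {1..m}. \<exists>(B :: 'd topology) \<psi> \<tau>. etale_map B Y \<psi> \<and>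
          \<psi> ` topspace B = \<phi> i ` topspace (A i) \<and>
          continuous_map B E \<tau> \<and> (\<forall>b \<in> topspace B. f (\<tau> b) = \<psi> b)"
    using A by (intro ballI etale_map_transfer[OF inj]) auto
  then obtain B :: "nat \<Rightarrow> 'd topology" and \<psi> \<tau> where
    B: "\<forall>i \<in> {1..m}. etale_map (B i) Y (\<psi> i) \<and> \<psi> i ` topspace (B i) = \<phi> i ` topspace (A i) \<and>
          continuous_map (B i) E (\<tau> i) \<and> (\<forall>b \<in> topspace (B i). f (\<tau> i b) = \<psi> i b)"
    by metis
  moreover have "topspace Y = (\<Union>i \<in> {1..m}. \<psi> i ` topspace (B i))"
    using A(2) B by auto
  ultimately show ?thesis
    unfolding has_etale_sections_def by blast
qed

section \<open>Path spaces and etale topological complexity\<close>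

text \<open>
  The points of the mapping space are the continuous maps, represented by functions that are
  \<open>undefined\<close> outside \<open>topspace S\<close>. The given family is a subbasis; its member for
  \<open>K = {}\<close> is the whole mapping space.
\<close>

definition compact_open_topology :: "'s topology \<Rightarrow> 'a topology \<Rightarrow> ('s \<Rightarrow> 'a) topology" where
  "compact_open_topology S X = topology_generated_by
     {{g \<in> extensional (topspace S). continuous_map S X g \<and> g ` K \<subseteq> V} | K V.
        compactin S K \<and> openin X V}"

definition path_space :: "'a topology \<Rightarrow> (real \<Rightarrow> 'a) topology" where
  "path_space X = compact_open_topology (top_of_set {0..1}) X"

lemma topspace_path_space:
  "topspace (path_space X) = {g \<in> extensional {0..1}. pathin X g}"
proof -
  have "{g \<in> extensional {0..1}. pathin X g} =
      {g \<in> extensional (topspace (top_of_set {0..1})).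
        continuous_map (top_of_set {0..1}) X g \<and> g ` {} \<subseteq> {}}" (is "?M = _")
    by (simp add: pathin_def)
  then have "?M \<in> {{g \<in> extensional (topspace (top_of_set {0..1})).
        continuous_map (top_of_set {0..1}) X g \<and> g ` K \<subseteq> V} | K V.
        compactin (top_of_set {0..1}) K \<and> openin X V}" (is "_ \<in> ?S")
    by (intro CollectI exI[of _ "{}"] conjI) simp_all
  moreover have "W \<subseteq> ?M" if "W \<in> ?S" for W
    using that by (auto simp: pathin_def)
  ultimately have "\<Union> ?S = ?M" by blast
  then show ?thesis
    unfolding path_space_def compact_open_topology_def topology_generated_by_topspace .
qed

definition path_endpoints :: "(real \<Rightarrow> 'a) \<Rightarrow> 'a \<times> 'a" where
  "path_endpoints \<gamma> = (\<gamma> 0, \<gamma> 1)"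

lemma continuous_map_path_endpoints:
  "continuous_map (path_space X) (prod_topology X X) path_endpoints"
proof -
  have "continuous_map (path_space X) X (\<lambda>g. g t)" if t: "t \<in> {0..1}" for t
    unfolding continuous_map
  proof (intro conjI allI impI)
    show "(\<lambda>g. g t) ` topspace (path_space X) \<subseteq> topspace X"
      using t unfolding topspace_path_space pathin_def continuous_map by auto
    fix V assume V: "openin X V"
    have "{g \<in> topspace (path_space X). g t \<in> V} =
        {g \<in> extensional (topspace (top_of_set {0..1})).
          continuous_map (top_of_set {0..1}) X g \<and> g ` {t} \<subseteq> V}"
      unfolding topspace_path_space pathin_def by auto
    moreover have "compactin (top_of_set {0..1}) {t}"
      using t by simp
    ultimately show "openin (path_space X) {g \<in> topspace (path_space X). g t \<in> V}"
      using V unfolding path_space_def compact_open_topology_def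
      by (intro topology_generated_by_Basis CollectI exI[of _ "{t}"] exI[of _ V] conjI)
  qed
  then show ?thesis
    unfolding path_endpoints_def continuous_map_pairwise by (simp add: o_def)
qed

definition etale_TC :: "'c itself \<Rightarrow> 'a topology \<Rightarrow> enat" where
  "etale_TC U X = etale_sec U (path_space X) (prod_topology X X) path_endpoints"

text \<open>
  Only the inclusion into the whole space is required to be null-homotopic, and only for one
  neighbourhood of each point.
\<close>

definition locally_contractible_space :: "'a topology \<Rightarrow> bool" where
  "locally_contractible_space X \<longleftrightarrow>
     (\<forall>x \<in> topspace X. \<exists>U. openin X U \<and> x \<in> U \<and>
        (\<exists>c. homotopic_with (\<lambda>_. True) (subtopology X U) X (\<lambda>u. u) (\<lambda>_. c)))"

end

theory Submission
  imports Defs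
begin

text \<open>
  Two equivalences carry the proof.

  First, etale maps are no more useful than open subsets. An etale map has a local inverse near each
  of its points, so a lift of \<open>f\<close> over it restricts to honest local sections of \<open>f\<close>. In the other
  direction, the disjoint union of an open cover of \<open>Y\<close> by sets with a section is a \<^emph>\<open>single\<close> etale
  space over \<open>Y\<close>, because etale maps need not be injective or have connected domains. So the etale
  sectional number is \<open>1\<close> if \<open>f\<close> has local sections near every point, and \<open>\<infinity>\<close> otherwise
  (\<open>etale_sec_eq\<close>).

  Second, by the exponential law for the compact interval, a section of the endpoint map over
  \<open>W \<subseteq> X \<times> X\<close> is the same thing as a homotopy between the two projections \<open>W \<rightarrow> X\<close>
  (\<open>homotopic_iff_lift_to_path_space\<close>). Given such a homotopy near \<open>(x, x)\<close>, restricting it to a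
  slice \<open>U \<times> {x}\<close> contracts \<open>U\<close> to \<open>x\<close> inside \<open>X\<close>. Conversely, if \<open>U\<close> and \<open>V\<close> contract inside \<open>X\<close>,
  both projections from \<open>U \<times> V\<close> are null-homotopic, hence homotopic to each other since \<open>X\<close> is
  path-connected. So the endpoint map has local sections exactly when \<open>X\<close> is locally contractible.
\<close>

section \<open>The etale sectional number and local sections\<close>

definition has_local_sections :: "'e topology \<Rightarrow> 'y topology \<Rightarrow> ('e \<Rightarrow> 'y) \<Rightarrow> bool" where
  "has_local_sections E Y f \<longleftrightarrow>
     (\<forall>y \<in> topspace Y. \<exists>V s. openin Y V \<and> y \<in> V \<and>
        continuous_map (subtopology Y V) E s \<and> (\<forall>v \<in> V. f (s v) = v))"

text \<open>
  If \<open>r\<close> inverts the etale map \<open>\<phi>\<close> near one of its points and \<open>\<sigma>\<close> lifts \<open>\<phi>\<close> through \<open>f\<close>, then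
  \<open>\<sigma> \<circ> r\<close> is a section of \<open>f\<close> over an open set.
\<close>

lemma has_etale_sections_imp_has_local_sections:
  assumes "has_etale_sections TYPE('c) E Y f m"
  shows "has_local_sections E Y f"
  unfolding has_local_sections_def
proof
  fix y assume "y \<in> topspace Y"
  moreover obtain A :: "nat \<Rightarrow> 'c topology" and \<phi> \<sigma> where
    et: "\<forall>i \<in> {1..m}. etale_map (A i) Y (\<phi> i)" and
    cov: "topspace Y = (\<Union>i \<in> {1..m}. \<phi> i ` topspace (A i))" and
    sec: "\<forall>i \<in> {1..m}. continuous_map (A i) E (\<sigma> i) \<and> (\<forall>a \<in> topspace (A i). f (\<sigma> i a) = \<phi> i a)"
    using assms unfolding has_etale_sections_def by blast
  ultimately obtain i a where i: "i \<in> {1..m}" and a: "a \<in> topspace (A i)" "y = \<phi> i a"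
    by auto
  obtain U where U: "openin (A i) U" "a \<in> U" "openin Y (\<phi> i ` U)"
      "homeomorphic_map (subtopology (A i) U) (subtopology Y (\<phi> i ` U)) (\<phi> i)"
    using et i a(1) unfolding etale_map_def by blast
  obtain r where r: "homeomorphic_maps (subtopology (A i) U) (subtopology Y (\<phi> i ` U)) (\<phi> i) r"
    using U(4) homeomorphic_map_maps by blast
  have cr: "continuous_map (subtopology Y (\<phi> i ` U)) (A i) r"
    using r by (auto simp: homeomorphic_maps_def continuous_map_in_subtopology)
  have \<phi>r: "r v \<in> topspace (A i)" "\<phi> i (r v) = v" if "v \<in> \<phi> i ` U" for v
  proof -
    have "v \<in> topspace (subtopology Y (\<phi> i ` U))"
      using that openin_subset[OF U(3)] by auto
    then show "r v \<in> topspace (A i)" "\<phi> i (r v) = v"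
      using r cr by (auto simp: homeomorphic_maps_def continuous_map_def)
  qed
  have "continuous_map (subtopology Y (\<phi> i ` U)) E (\<sigma> i \<circ> r)"
    using cr sec i continuous_map_compose by blast
  moreover have "\<forall>v \<in> \<phi> i ` U. f ((\<sigma> i \<circ> r) v) = v"
    using sec i \<phi>r by simp
  ultimately show "\<exists>V s. openin Y V \<and> y \<in> V \<and>
        continuous_map (subtopology Y V) E s \<and> (\<forall>v \<in> V. f (s v) = v)"
    using U(2,3) a(2) by blast
qed

text \<open>
  The copy \<open>{j} \<times> V j\<close> of \<open>V j\<close> is open in the disjoint union and projects homeomorphically onto
  the open set \<open>V j\<close>.
\<close>

lemma etale_map_sum_of_open_subspaces:
  assumes V: "\<And>j. j \<in> J \<Longrightarrow> openin Y (V j)"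
  shows "etale_map (sum_topology (\<lambda>j. subtopology Y (V j)) J) Y snd"
proof -
  let ?P = "sum_topology (\<lambda>j. subtopology Y (V j)) J"
  have csnd: "continuous_map ?P Y snd"
    by (rule continuous_map_from_sum_topology) (simp add: continuous_map_from_subtopology)
  show ?thesis
    unfolding etale_map_def
  proof (intro conjI ballI csnd)
    fix p assume "p \<in> topspace ?P"
    then obtain j z where p: "p = (j, z)" and j: "j \<in> J" and z: "z \<in> V j"
      by auto
    let ?U = "{j} \<times> V j"
    have im: "snd ` ?U = V j" by force
    have "openin ?P ?U"
      unfolding openin_sum_topology
    proof (intro conjI ballI)
      show "?U \<subseteq> Sigma J (topspace \<circ> (\<lambda>j. subtopology Y (V j)))"
        using j openin_subset[OF V[OF j]] by auto
      show "openin (subtopology Y (V i)) {x. (i, x) \<in> ?U}" if "i \<in> J" for i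
        using V[OF j] by (cases "i = j") (simp_all add: openin_open_subtopology)
    qed
    moreover have "homeomorphic_maps (subtopology ?P ?U) (subtopology Y (V j)) snd (Pair j)"
      unfolding homeomorphic_maps_def
    proof (intro conjI)
      show "continuous_map (subtopology ?P ?U) (subtopology Y (V j)) snd"
        using csnd by (auto simp: continuous_map_in_subtopology continuous_map_from_subtopology)
      show "continuous_map (subtopology Y (V j)) (subtopology ?P ?U) (Pair j)"
        using continuous_map_component_injection[OF j, of "\<lambda>j. subtopology Y (V j)"]
        by (auto simp: continuous_map_in_subtopology)
    qed auto
    ultimately show "\<exists>U. openin ?P U \<and> p \<in> U \<and> openin Y (snd ` U) \<and>
        homeomorphic_map (subtopology ?P U) (subtopology Y (snd ` U)) snd"
      using im V[OF j] z p homeomorphic_map_maps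
      by (intro exI[of _ ?U]) auto
  qed
qed

text \<open>
  Indexing the open sets by the points of \<open>Y\<close> that they surround makes their disjoint union a space
  with points in \<open>'y \<times> 'y\<close>; sections over the pieces glue because there are no overlaps.
\<close>

lemma has_local_sections_imp_has_etale_sections:
  fixes Y :: "'y topology"
  assumes "has_local_sections E Y f"
  shows "has_etale_sections TYPE('y \<times> 'y) E Y f 1"
proof -
  obtain V s where V: "\<And>y. y \<in> topspace Y \<Longrightarrow> openin Y (V y) \<and> y \<in> V y \<and>
        continuous_map (subtopology Y (V y)) E (s y) \<and> (\<forall>v \<in> V y. f (s y v) = v)"
    using assms unfolding has_local_sections_def by metis
  let ?P = "sum_topology (\<lambda>y. subtopology Y (V y)) (topspace Y)"
  have "etale_map ?P Y snd"
    using V by (intro etale_map_sum_of_open_subspaces) blast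
  moreover have "topspace Y = snd ` topspace ?P"
    using V by force
  moreover have "continuous_map ?P E (\<lambda>(y, v). s y v)"
    using V by (intro continuous_map_from_sum_topology) simp
  moreover have "\<forall>p \<in> topspace ?P. f (case p of (y, v) \<Rightarrow> s y v) = snd p"
    using V by auto
  ultimately show ?thesis
    unfolding has_etale_sections_def
    by (intro exI[of _ "\<lambda>_. ?P"] exI[of _ "\<lambda>_. snd"] exI[of _ "\<lambda>_ (y, v). s y v"]) simp
qed

text \<open>
  The embedding \<open>\<iota>\<close> makes the universe \<open>'c\<close> large enough to contain the disjoint union above.
\<close>

theorem etale_sec_eq:
  fixes Y :: "'y topology" and \<iota> :: "'y \<times> 'y \<Rightarrow> 'c"
  assumes "inj \<iota>"
  shows "etale_sec TYPE('c) E Y f = (if has_local_sections E Y f then 1 else \<infinity>)"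
proof (cases "has_local_sections E Y f")
  case True
  let ?M = "{enat m | m. m \<ge> 1 \<and> has_etale_sections TYPE('c) E Y f m}"
  have "has_etale_sections TYPE('c) E Y f 1"
    using has_etale_sections_universe[OF assms] has_local_sections_imp_has_etale_sections[OF True]
    by blast
  then have "1 \<in> ?M" by (auto simp: one_enat_def)
  moreover have "1 \<le> n" if "n \<in> ?M" for n
    using that by (auto simp: one_enat_def)
  ultimately have "Inf ?M = 1"
    by (intro antisym Inf_lower Inf_greatest)
  with True show ?thesis by (simp add: etale_sec_def)
next
  case False
  then have none: "\<not> has_etale_sections TYPE('c) E Y f m" for m
    using has_etale_sections_imp_has_local_sections by blast
  have "{enat m | m. m \<ge> 1 \<and> has_etale_sections TYPE('c) E Y f m} = {}"
    by (simp add: none)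
  with False show ?thesis by (simp add: etale_sec_def Inf_enat_def)
qed

section \<open>Homotopies as maps into the path space\<close>

text \<open>
  Evaluation is jointly continuous because the interval is locally compact: a path that sends \<open>t\<close>
  into \<open>V\<close> sends a whole compact neighbourhood \<open>K\<close> of \<open>t\<close> into \<open>V\<close>, and doing so is an open
  condition on paths.
\<close>

lemma continuous_map_path_evaluation:
  "continuous_map (prod_topology (path_space X) (top_of_set {0..1})) X (\<lambda>(g, t). g t)"
  unfolding continuous_map
proof (intro conjI allI impI)
  let ?I = "top_of_set {0..1::real}"
  show "(\<lambda>(g, t). g t) ` topspace (prod_topology (path_space X) ?I) \<subseteq> topspace X"
    by (auto simp: topspace_path_space pathin_def continuous_map_def)
  fix V assume V: "openin X V"
  let ?S = "{p \<in> topspace (prod_topology (path_space X) ?I). (case p of (g, t) \<Rightarrow> g t) \<in> V}"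
  have nbhd: "\<exists>M T. openin (path_space X) M \<and> openin ?I T \<and> g \<in> M \<and> t \<in> T \<and> M \<times> T \<subseteq> ?S"
    if "(g, t) \<in> ?S" for g t
  proof -
    have g: "g \<in> extensional {0..1}" "continuous_map ?I X g" and t: "t \<in> {0..1}" "g t \<in> V"
      using that by (auto simp: topspace_path_space pathin_def)
    have "openin ?I {t \<in> topspace ?I. g t \<in> V}"
      using g(2) V by (rule openin_continuous_map_preimage)
    then obtain O' where O': "open O'" "{t \<in> {0..1}. g t \<in> V} = {0..1} \<inter> O'"
      unfolding openin_open by auto
    then obtain e where e: "e > 0" "cball t e \<subseteq> O'"
      using t open_contains_cball by blast
    define K where "K = {0..1} \<inter> cball t e"
    define M where "M = {g \<in> extensional (topspace ?I). continuous_map ?I X g \<and> g ` K \<subseteq> V}"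
    have "compactin ?I K"
      unfolding K_def compactin_subtopology by (auto intro: compact_Int)
    then have "openin (path_space X) M"
      unfolding path_space_def compact_open_topology_def M_def using V
      by (intro topology_generated_by_Basis) blast
    moreover have "openin ?I ({0..1} \<inter> ball t e)"
      by blast
    moreover have "g \<in> M"
      using g O'(2) e(2) by (auto simp: M_def K_def)
    moreover have "M \<times> ({0..1} \<inter> ball t e) \<subseteq> ?S"
      by (auto simp: M_def K_def topspace_path_space pathin_def)
    ultimately show ?thesis
      using t e(1) by (intro exI[of _ M] exI[of _ "{0..1} \<inter> ball t e"]) auto
  qed
  show "openin (prod_topology (path_space X) ?I) ?S"
    unfolding openin_prod_topology_alt by (intro allI impI nbhd)
qed

text \<open>
  The parameters \<open>z\<close> whose path fails to send \<open>K\<close> into \<open>V\<close> form the image of a closed set under the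
  projection along the compact interval, which is a closed map. The restriction to the interval puts
  the paths into their extensional representation.
\<close>

lemma continuous_map_into_path_space:
  assumes h: "continuous_map (prod_topology Z (top_of_set {0..1})) X h"
  shows "continuous_map Z (path_space X) (\<lambda>z. restrict (\<lambda>t. h (z, t)) {0..1})"
    (is "continuous_map Z _ ?s")
proof -
  let ?I = "top_of_set {0..1::real}"
  have path: "continuous_map ?I X (?s z)" if z: "z \<in> topspace Z" for z
  proof -
    have "continuous_map ?I (prod_topology Z ?I) (Pair z)"
      using z by (simp add: continuous_map_pairwise o_def continuous_map_id[unfolded id_def])
    then have "continuous_map ?I X (h \<circ> Pair z)"
      using h by (rule continuous_map_compose)
    then show ?thesis
      by (rule continuous_map_eq) simp
  qed
  have "openin Z {z \<in> topspace Z. ?s z ` K \<subseteq> V}"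
    if K: "compactin ?I K" and V: "openin X V" for K V
  proof -
    let ?C = "{p \<in> topspace (prod_topology Z ?I). h p \<in> topspace X - V} \<inter> topspace Z \<times> K"
    have "closedin ?I K"
      using K by (intro compactin_imp_closedin) (auto intro: Hausdorff_space_subtopology)
    then have "closedin (prod_topology Z ?I) ?C"
      using V by (intro closedin_Int closedin_continuous_map_preimage[OF h])
        (auto simp: closedin_prod_Times_iff)
    moreover have "closed_map (prod_topology Z ?I) Z fst"
      by (rule closed_map_fst) (simp add: compact_space_subtopology)
    ultimately have "closedin Z (fst ` ?C)"
      by (simp add: closed_map_def)
    moreover have "{z \<in> topspace Z. ?s z ` K \<subseteq> V} = topspace Z - fst ` ?C"
    proof -
      have KI: "t \<in> {0..1}" if "t \<in> K" for t
        using compactin_subset_topspace[OF K] that by auto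
      have "h (z, t) \<in> topspace X" if "z \<in> topspace Z" "t \<in> {0..1}" for z t
        using h that by (auto simp: continuous_map_def)
      then have "z \<in> fst ` ?C \<longleftrightarrow> z \<in> topspace Z \<and> (\<exists>t \<in> K. h (z, t) \<notin> V)" for z
        using KI unfolding image_iff by (simp add: Bex_def) blast
      moreover have "?s z ` K \<subseteq> V \<longleftrightarrow> (\<forall>t \<in> K. h (z, t) \<in> V)" for z
        using KI unfolding image_subset_iff by (intro ball_cong refl) (simp only: restrict_apply if_True)
      ultimately show ?thesis by blast
    qed
    ultimately show ?thesis by auto
  qed
  moreover have "?s -` {g \<in> extensional (topspace ?I). continuous_map ?I X g \<and> g ` K \<subseteq> V}
      \<inter> topspace Z = {z \<in> topspace Z. ?s z ` K \<subseteq> V}" for K V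
    using path by auto
  moreover have "?s ` topspace Z \<subseteq> topspace (path_space X)"
    using path by (auto simp: topspace_path_space pathin_def)
  ultimately show ?thesis
    unfolding path_space_def compact_open_topology_def continuous_on_generated_topo_iff
      topology_generated_by_topspace
    by fastforce
qed

text \<open>
  The exponential law, stated with the endpoint conditions: the previous two lemmas give its two
  directions.
\<close>

lemma homotopic_iff_lift_to_path_space:
  "homotopic_with (\<lambda>_. True) Z X p q \<longleftrightarrow>
     (\<exists>s. continuous_map Z (path_space X) s \<and>
        (\<forall>z \<in> topspace Z. path_endpoints (s z) = (p z, q z)))"
proof
  let ?I = "top_of_set {0..1::real}"
  assume "homotopic_with (\<lambda>_. True) Z X p q"
  then obtain h where h: "continuous_map (prod_topology ?I Z) X h"
      "\<forall>z \<in> topspace Z. h (0, z) = p z" "\<forall>z \<in> topspace Z. h (1, z) = q z"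
    using homotopic_with[of Z "\<lambda>_. True" X p q] by auto
  have "continuous_map (prod_topology Z ?I) (prod_topology ?I Z) (\<lambda>x. (snd x, fst x))"
    by (simp add: continuous_map_paired continuous_map_fst continuous_map_snd)
  then have "continuous_map (prod_topology Z ?I) X (h \<circ> (\<lambda>x. (snd x, fst x)))"
    using h(1) by (rule continuous_map_compose)
  from continuous_map_into_path_space[OF this] h(2,3)
  show "\<exists>s. continuous_map Z (path_space X) s \<and>
        (\<forall>z \<in> topspace Z. path_endpoints (s z) = (p z, q z))"
    by (intro exI conjI) (auto simp: path_endpoints_def)
next
  let ?I = "top_of_set {0..1::real}"
  assume "\<exists>s. continuous_map Z (path_space X) s \<and>
        (\<forall>z \<in> topspace Z. path_endpoints (s z) = (p z, q z))"
  then obtain s where s: "continuous_map Z (path_space X) s"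
      "\<forall>z \<in> topspace Z. path_endpoints (s z) = (p z, q z)" by blast
  have "continuous_map (prod_topology ?I Z) (prod_topology (path_space X) ?I)
      (\<lambda>x. (s (snd x), fst x))"
    using s(1) by (simp add: continuous_map_paired continuous_map_fst
        continuous_map_compose[OF continuous_map_snd, unfolded o_def])
  from continuous_map_compose[OF this continuous_map_path_evaluation]
  have "continuous_map (prod_topology ?I Z) X (\<lambda>x. s (snd x) (fst x))"
    by (simp add: o_def)
  moreover have "s z 0 = p z" "s z 1 = q z" if "z \<in> topspace Z" for z
    using s(2) that by (simp_all add: path_endpoints_def)
  ultimately show "homotopic_with (\<lambda>_. True) Z X p q"
    by (subst homotopic_with) (simp_all add: exI[of _ "\<lambda>x. s (snd x) (fst x)"])
qed

section \<open>Local sections of the endpoint map\<close>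

lemma locally_contractible_if_local_path_sections:
  assumes "has_local_sections (path_space X) (prod_topology X X) path_endpoints"
  shows "locally_contractible_space X"
  unfolding locally_contractible_space_def
proof
  fix x assume x: "x \<in> topspace X"
  obtain W s where W: "openin (prod_topology X X) W" "(x, x) \<in> W"
      "continuous_map (subtopology (prod_topology X X) W) (path_space X) s"
      "\<forall>w \<in> W. path_endpoints (s w) = w"
    using assms x unfolding has_local_sections_def by fastforce
  obtain U V where U: "openin X U" "x \<in> U" "openin X V" "x \<in> V" "U \<times> V \<subseteq> W"
    using W(1,2) unfolding openin_prod_topology_alt by blast
  \<comment> \<open>On the slice \<open>u \<mapsto> (u, x)\<close> the projections become the inclusion and the constant map \<open>x\<close>.\<close>
  have "homotopic_with (\<lambda>_. True) (subtopology (prod_topology X X) W) X fst snd"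
    unfolding homotopic_iff_lift_to_path_space using W(3,4) by auto
  moreover have "continuous_map (subtopology X U) (subtopology (prod_topology X X) W) (\<lambda>u. (u, x))"
    using U x by (auto simp: continuous_map_in_subtopology continuous_map_pairwise o_def
        continuous_map_from_subtopology)
  ultimately have "homotopic_with (\<lambda>_. True) (subtopology X U) X
      (fst \<circ> (\<lambda>u. (u, x))) (snd \<circ> (\<lambda>u. (u, x)))"
    by (rule homotopic_with_compose_continuous_map_right) auto
  then show "\<exists>U. openin X U \<and> x \<in> U \<and>
        (\<exists>c. homotopic_with (\<lambda>_. True) (subtopology X U) X (\<lambda>u. u) (\<lambda>_. c))"
    using U(1,2) by (auto simp: o_def)
qed

text \<open>
  Passing through homotopies rather than paths replaces the explicit concatenation (contract \<open>U\<close>,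
  move from \<open>c\<close> to \<open>d\<close>, expand \<open>V\<close>) by symmetry and transitivity of homotopy.
\<close>

lemma local_path_sections_if_locally_contractible:
  assumes conn: "path_connected_space X" and "locally_contractible_space X"
  shows "has_local_sections (path_space X) (prod_topology X X) path_endpoints"
  unfolding has_local_sections_def
proof
  fix z assume "z \<in> topspace (prod_topology X X)"
  then obtain x y where z: "z = (x, y)" "x \<in> topspace X" "y \<in> topspace X" by auto
  obtain U c where U: "openin X U" "x \<in> U"
      "homotopic_with (\<lambda>_. True) (subtopology X U) X (\<lambda>u. u) (\<lambda>_. c)"
    using assms(2) z(2) unfolding locally_contractible_space_def by blast
  obtain V d where V: "openin X V" "y \<in> V"
      "homotopic_with (\<lambda>_. True) (subtopology X V) X (\<lambda>u. u) (\<lambda>_. d)"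
    using assms(2) z(3) unfolding locally_contractible_space_def by blast
  let ?W = "subtopology (prod_topology X X) (U \<times> V)"
  \<comment> \<open>A constant map on a nonempty space takes its value in \<open>X\<close>; this puts \<open>c\<close> and \<open>d\<close> in \<open>X\<close>,
      where path-connectedness applies to them.\<close>
  have "continuous_map (subtopology X U) X (\<lambda>_. c)" "continuous_map (subtopology X V) X (\<lambda>_. d)"
    using U(3) V(3) homotopic_with_imp_continuous_maps by blast+
  moreover have "x \<in> topspace (subtopology X U)" "y \<in> topspace (subtopology X V)"
    using U(2) V(2) z by simp_all
  ultimately have cd: "c \<in> topspace X" "d \<in> topspace X"
    unfolding continuous_map_def by blast+
  have "continuous_map ?W (subtopology X U) fst" "continuous_map ?W (subtopology X V) snd"
    by (auto simp: continuous_map_in_subtopology continuous_map_from_subtopology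
        continuous_map_fst continuous_map_snd)
  then have "homotopic_with (\<lambda>_. True) ?W X fst (\<lambda>_. c)"
      and "homotopic_with (\<lambda>_. True) ?W X snd (\<lambda>_. d)"
    using homotopic_with_compose_continuous_map_right[OF U(3), of ?W fst]
      homotopic_with_compose_continuous_map_right[OF V(3), of ?W snd]
    by (simp_all add: o_def)
  moreover have "homotopic_with (\<lambda>_. True) ?W X (\<lambda>_. c) (\<lambda>_. d)"
    using conn cd by (auto simp: homotopic_constant_maps path_connected_space_iff_path_component)
  ultimately have "homotopic_with (\<lambda>_. True) ?W X fst snd"
    by (meson homotopic_with_sym homotopic_with_trans)
  then obtain s where s: "continuous_map ?W (path_space X) s"
      "\<forall>w \<in> topspace ?W. path_endpoints (s w) = (fst w, snd w)"
    unfolding homotopic_iff_lift_to_path_space by blast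
  have "topspace ?W = U \<times> V"
    using openin_subset[OF U(1)] openin_subset[OF V(1)] by auto
  moreover have "openin (prod_topology X X) (U \<times> V)"
    using U(1) V(1) by (simp add: openin_prod_Times_iff)
  ultimately show "\<exists>V s. openin (prod_topology X X) V \<and> z \<in> V \<and>
      continuous_map (subtopology (prod_topology X X) V) (path_space X) s \<and>
      (\<forall>v \<in> V. path_endpoints (s v) = v)"
    using s U(2) V(2) z(1) by (intro exI[of _ "U \<times> V"] exI[of _ s]) auto
qed

section \<open>Etale topological complexity\<close>

theorem theorem2p5:
  fixes X :: "'a topology" and \<iota> :: "('a \<times> 'a) \<times> ('a \<times> 'a) \<Rightarrow> 'c"
  assumes "path_connected_space X"
    and "inj \<iota>"
  shows "etale_TC TYPE('c) X = (if locally_contractible_space X then 1 else \<infinity>)"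
proof -
  have "has_local_sections (path_space X) (prod_topology X X) path_endpoints \<longleftrightarrow>
      locally_contractible_space X"
    using locally_contractible_if_local_path_sections
      local_path_sections_if_locally_contractible[OF assms(1)] by blast
  then show ?thesis
    unfolding etale_TC_def etale_sec_eq[OF assms(2)] by simp
qed

end
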